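(* Let $S$ be an unbounded characteristic subset of $[0,\infty)$. Let $X$ be an ultranormal $\sigma$-compact locally compact Hausdorff space, and let $A$ be a non-empty closed subset of $X$. If $d\in \mathrm{UMet}(A;S)$ is proper, then there exists a proper metric $D\in \mathrm{UMet}(X;S)$ such that $D|_{A^{2}}=d$.
   Context: A metric $d$ on a set $X$ is an ultrametric if $d(x,y)\le \max\{d(x,z),d(z,y)\}$ for all $x,y,z\in X$. For a topological space $X$ and $S\subset[0,\infty)$ with $0\in S$, $\mathrm{UMet}(X;S)$ denotes the set of all ultrametrics on $X$ that take values in $S$ and generate the given topology of $X$. A subset $A$ of $X$ carries the subspace topology. A subset $S$ of $[0,\infty)$ is characteristic if $0\in S$ and for every $r\in(0,\infty)$ there exists $s\in S\setminus\{0\}$ with $s\le r$. A topological space $X$ is ultranormal if for every pair $A,B$ of disjoint closed subsets of $X$ there is a clopen set $V$ with $A\subset V$ and $V\cap B=\emptyset$. A metric is proper if all bounded closed subsets are compact. A space is $\sigma$-compact if it is a countable union of compact subspaces, and locally compact if every point has a compact neighborhood.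
   Formalization: X is additionally assumed metrizable; without this the claim fails, e.g. for the one-point compactification of an uncountable discrete space with A the point at infinity, and metrizability is implied by the existence of D. *)

theory Defs
  imports "HOL-Analysis.Analysis"
begin

definition ultrametric_on :: "'a set \<Rightarrow> ('a \<Rightarrow> 'a \<Rightarrow> real) \<Rightarrow> bool" where
  "ultrametric_on M d \<longleftrightarrow>
     Metric_space M d \<and> (\<forall>x\<in>M. \<forall>y\<in>M. \<forall>z\<in>M. d x y \<le> max (d x z) (d z y))"

text \<open>
  Metrics are total functions of which only the values on the carrier matter. The locale
  \<^locale>\<open>Metric_space\<close> also asks for symmetry and non-negativity off the carrier; every metric
  on \<open>M\<close> meets this after extension by \<open>0\<close>, so no metric is excluded.
\<close>

definition UMet :: "'a topology \<Rightarrow> real set \<Rightarrow> ('a \<Rightarrow> 'a \<Rightarrow> real) set" where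
  "UMet X S = {d. ultrametric_on (topspace X) d
                \<and> (\<forall>x\<in>topspace X. \<forall>y\<in>topspace X. d x y \<in> S)
                \<and> Metric_space.mtopology (topspace X) d = X}"

definition characteristic :: "real set \<Rightarrow> bool" where
  "characteristic S \<longleftrightarrow> S \<subseteq> {0..} \<and> 0 \<in> S \<and> (\<forall>r>0. \<exists>s\<in>S - {0}. s \<le> r)"

definition ultranormal_space :: "'a topology \<Rightarrow> bool" where
  "ultranormal_space X \<longleftrightarrow>
     (\<forall>A B. closedin X A \<and> closedin X B \<and> disjnt A B \<longrightarrow>
        (\<exists>V. openin X V \<and> closedin X V \<and> A \<subseteq> V \<and> V \<inter> B = {}))"

definition sigma_compact_space :: "'a topology \<Rightarrow> bool" where
  "sigma_compact_space X \<longleftrightarrow>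
     (\<exists>\<K>. countable \<K> \<and> (\<forall>K\<in>\<K>. compactin X K) \<and> topspace X = \<Union>\<K>)"

definition proper_metric_on :: "'a set \<Rightarrow> ('a \<Rightarrow> 'a \<Rightarrow> real) \<Rightarrow> bool" where
  "proper_metric_on M d \<longleftrightarrow> Metric_space M d \<and>
     (\<forall>C. closedin (Metric_space.mtopology M d) C \<and> Metric_space.mbounded M d C
        \<longrightarrow> compactin (Metric_space.mtopology M d) C)"

text \<open>
  A space with an element of \<^const>\<open>UMet\<close> is metrizable, which does not follow from being
  ultranormal, \<open>\<sigma>\<close>-compact, locally compact and Hausdorff: the one-point compactification of an
  uncountable discrete space has these properties without being first countable. Extending a
  metric from a closed subset (already from a single point) to the whole space therefore needs
  metrizability of that space as a hypothesis of its own.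
\<close>

lemma UMet_imp_metrizable_space:
  assumes "D \<in> UMet X S"
  shows "metrizable_space X"
  using assms unfolding UMet_def ultrametric_on_def metrizable_space_def by fastforce

end

theory Submission
  imports Defs
begin

text \<open>
  The space has a countable cover by compact clopen sets \<open>U\<^sub>n\<close> that separates points. It yields
  a proper ultrametric \<open>u\<close> on \<open>X\<close>: the first index at which \<open>x\<close> and \<open>y\<close> are separated contributes
  a small value of \<open>S\<close>, the first index with \<open>x \<in> U\<^sub>n\<close> a large one. Properness of \<open>u\<close> provides
  nearest points in \<open>A\<close>, and choosing the same nearest point for points with the same set of nearest
  points gives a continuous retraction \<open>r\<close> onto \<open>A\<close>. The extension is the maximum of \<open>d (r x) (r y)\<close>
  and the ultrametric that \<open>u\<close> induces on the quotient \<open>X/A\<close>; the latter vanishes on \<open>A\<close>, separates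
  the points off \<open>A\<close>, takes only values of \<open>u\<close>, and controls the distance from \<open>x\<close> to \<open>r x\<close>, whence
  properness.
\<close>

section \<open>A criterion for proper ultrametrics in \<open>UMet\<close>\<close>

text \<open>
  Only one inclusion of the topologies has to be assumed: relatively compact balls force the
  coarser metric topology to agree with \<open>X\<close>.
\<close>

lemma UMet_properI:
  assumes ultra: "ultrametric_on (topspace X) D"
    and vals: "\<And>x y. x \<in> topspace X \<Longrightarrow> y \<in> topspace X \<Longrightarrow> D x y \<in> S"
    and nbhd: "\<And>x \<epsilon>. x \<in> topspace X \<Longrightarrow> \<epsilon> > 0 \<Longrightarrow>
                 \<exists>U. openin X U \<and> x \<in> U \<and> (\<forall>y\<in>U. D x y < \<epsilon>)"
    and bdd: "\<And>x R. x \<in> topspace X \<Longrightarrow>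
                 \<exists>K. compactin X K \<and> {y \<in> topspace X. D x y \<le> R} \<subseteq> K"
  shows "D \<in> UMet X S" and "proper_metric_on (topspace X) D"
proof -
  interpret Metric_space "topspace X" D
    using ultra by (simp add: ultrametric_on_def)
  have coarser: "openin X U" if "openin mtopology U" for U
  proof (subst openin_subopen, intro ballI)
    fix x assume "x \<in> U"
    with that have x: "x \<in> topspace X" and "\<exists>r>0. mball x r \<subseteq> U"
      unfolding openin_mtopology by auto
    then obtain r where r: "r > 0" "mball x r \<subseteq> U"
      by blast
    obtain V where V: "openin X V" "x \<in> V" "\<forall>y\<in>V. D x y < r"
      using nbhd[OF x r(1)] by blast
    have "V \<subseteq> mball x r"
      using x V(3) openin_subset[OF V(1)] by auto
    with V r(2) show "\<exists>T. openin X T \<and> x \<in> T \<and> T \<subseteq> U"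
      by (intro exI[of _ V]) simp
  qed
  then have coarser_closed: "closedin X C" if "closedin mtopology C" for C
    using that by (simp add: closedin_def)
  have coarser_compact: "compactin mtopology C" if "compactin X C" for C
    using that coarser by (simp add: compactin_def)
  \<comment> \<open>A ball closed for \<open>D\<close> is also closed in the finer topology
    \<open>X\<close>, hence compact as a closed subset of the compact set given by
    \<open>bdd\<close>.\<close>
  have cball: "compactin X (mcball x R)" if x: "x \<in> topspace X" for x R
  proof -
    have "mcball x R = {y \<in> topspace X. D x y \<le> R}"
      using x by (simp add: mcball_def)
    then obtain K where "compactin X K" "mcball x R \<subseteq> K"
      using bdd[OF x, of R] by metis
    then show ?thesis
      by (rule closed_compactin) (rule coarser_closed[OF closedin_mcball])
  qed
  have finer: "openin mtopology U" if U: "openin X U" for U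
  proof (subst openin_subopen, intro ballI)
    fix x assume xU: "x \<in> U"
    then have x: "x \<in> topspace X"
      using U openin_subset by blast
    \<comment> \<open>The part of the complement of \<open>U\<close> near \<open>x\<close> is
      compact in \<open>X\<close>, so compact in the coarser metric topology, so closed there
      because that topology is Hausdorff. Removing it from the ball leaves a metric neighbourhood of
      \<open>x\<close> inside \<open>U\<close>. The radius 1 is arbitrary.\<close>
    define C where "C = (topspace X - U) \<inter> mcball x 1"
    have "compactin X C"
      unfolding C_def using U cball[OF x] by (intro closed_Int_compactin) auto
    then have "closedin mtopology C"
      by (rule compactin_imp_closedin[OF Hausdorff_space_mtopology coarser_compact])
    then have "openin mtopology (mball x 1 - C)"
      by (intro openin_diff) auto
    moreover have "x \<in> mball x 1 - C" "mball x 1 - C \<subseteq> U"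
      using x xU by (auto simp: C_def)
    ultimately show "\<exists>T. openin mtopology T \<and> x \<in> T \<and> T \<subseteq> U"
      by blast
  qed
  have eq: "mtopology = X"
    using coarser finer by (auto simp: topology_eq)
  show "D \<in> UMet X S"
    using ultra vals eq by (simp add: UMet_def)
  show "proper_metric_on (topspace X) D"
    unfolding proper_metric_on_def
  proof (intro conjI allI impI Metric_space_axioms)
    fix C assume C: "closedin mtopology C \<and> mbounded C"
    then obtain x B where "C \<subseteq> mcball x B"
      by (auto simp: mbounded_def)
    then show "compactin mtopology C"
      using C cball closed_compactin eq
      by (metis compactin_empty mcball_eq_empty subset_empty)
  qed
qed

lemma ultrametric_onI:
  assumes "\<And>x y. 0 \<le> d x y" and "\<And>x y. d x y = d y x"
    and "\<And>x y. \<lbrakk>x \<in> M; y \<in> M\<rbrakk> \<Longrightarrow> d x y = 0 \<longleftrightarrow> x = y"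
    and "\<And>x y z. \<lbrakk>x \<in> M; y \<in> M; z \<in> M\<rbrakk> \<Longrightarrow> d x y \<le> max (d x z) (d z y)"
  shows "ultrametric_on M d"
proof -
  have "Metric_space M d"
  proof
    fix x y z assume "x \<in> M" "y \<in> M" "z \<in> M"
    then show "d x z \<le> d x y + d y z"
      using assms(1)[of x y] assms(1)[of y z] assms(4)[of x z y] by linarith
  qed (use assms in auto)
  then show ?thesis
    using assms(4) by (auto simp: ultrametric_on_def)
qed

section \<open>Compact clopen sets\<close>

text \<open>Ultranormality separates \<open>x\<close> from the complement of
  \<open>U \<inter> W\<close>, where \<open>W\<close> is an open neighbourhood of \<open>x\<close>
  inside a compact set; a closed set between them is then compact.\<close>

lemma compact_clopen_nbhd:
  assumes "ultranormal_space X" "locally_compact_space X" "Hausdorff_space X"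
    and "openin X U" "x \<in> U"
  shows "\<exists>V. openin X V \<and> closedin X V \<and> compactin X V \<and> x \<in> V \<and> V \<subseteq> U"
proof -
  have x: "x \<in> topspace X"
    using assms openin_subset by blast
  then obtain W K where W: "openin X W" "compactin X K" "x \<in> W" "W \<subseteq> K"
    using assms(2) unfolding locally_compact_space_def by blast
  have "closedin X {x}" "closedin X (topspace X - U \<inter> W)"
    using assms x W by (auto simp: closedin_Hausdorff_singleton)
  then obtain V where V: "openin X V" "closedin X V" "{x} \<subseteq> V" "V \<inter> (topspace X - U \<inter> W) = {}"
    using assms(1,5) W(3) unfolding ultranormal_space_def
    by (metis DiffD2 IntI disjnt_insert1 disjnt_empty1)
  then have "V \<subseteq> U \<inter> W"
    using openin_subset by fastforce
  moreover from this have "compactin X V"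
    using W(2,4) V(2) by (intro closed_compactin[of X K V]) auto
  ultimately show ?thesis
    using V by (intro exI[of _ V]) auto
qed

text \<open>Each compact piece of \<open>X\<close> is covered, for every \<open>n\<close>, by
  finitely many compact clopen sets of size about \<open>1/(n+1)\<close>. Countably many pieces and
  scales give a countable family, and arbitrarily small members around every point separate
  points.\<close>

lemma countable_compact_clopen_cover:
  assumes "metrizable_space X" "ultranormal_space X" "sigma_compact_space X"
    and "locally_compact_space X" "Hausdorff_space X"
  obtains U :: "nat \<Rightarrow> 'a set"
  where "\<And>n. openin X (U n)" "\<And>n. closedin X (U n)" "\<And>n. compactin X (U n)"
    and "topspace X = (\<Union>n. U n)"
    and "\<And>x y. x \<in> topspace X \<Longrightarrow> y \<in> topspace X \<Longrightarrow> x \<noteq> y \<Longrightarrow> \<exists>n. x \<in> U n \<and> y \<notin> U n"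
proof -
  obtain M m where "Metric_space M m" and Xm: "X = Metric_space.mtopology M m"
    using assms(1) unfolding metrizable_space_def by blast
  then interpret Metric_space M m by simp
  have M: "topspace X = M"
    by (simp add: Xm)
  obtain \<K> where \<K>: "countable \<K>" "\<And>K. K \<in> \<K> \<Longrightarrow> compactin X K" "topspace X = \<Union>\<K>"
    using assms(3) unfolding sigma_compact_space_def by metis
  define \<B> where "\<B> n = {V. openin X V \<and> closedin X V \<and> compactin X V \<and>
                    (\<exists>c. V \<subseteq> mball c (inverse (Suc n)))}" for n
  have \<B>_cover: "\<exists>V\<in>\<B> n. x \<in> V" if "x \<in> M" for x n
  proof -
    have "openin X (mball x (inverse (Suc n)))"
      unfolding Xm by (rule openin_mball)
    moreover have "x \<in> mball x (inverse (Suc n))"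
      using that by simp
    ultimately obtain V where "openin X V" "closedin X V" "compactin X V" "x \<in> V"
      "V \<subseteq> mball x (inverse (Suc n))"
      using compact_clopen_nbhd[OF assms(2,4,5)] by meson
    then show ?thesis
      unfolding \<B>_def by blast
  qed
  have "\<exists>\<F>. finite \<F> \<and> \<F> \<subseteq> \<B> n \<and> K \<subseteq> \<Union>\<F>" if "K \<in> \<K>" for K n
  proof -
    have "K \<subseteq> \<Union>(\<B> n)"
      using \<B>_cover \<K>(3) M that by blast
    moreover have "\<forall>V\<in>\<B> n. openin X V"
      by (simp add: \<B>_def)
    ultimately show ?thesis
      using \<K>(2)[OF that] unfolding compactin_def by blast
  qed
  then obtain \<F> where \<F>: "\<And>K n. K \<in> \<K> \<Longrightarrow> finite (\<F> K n) \<and> \<F> K n \<subseteq> \<B> n \<and> K \<subseteq> \<Union>(\<F> K n)"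
    by metis
  \<comment> \<open>\<open>from_nat_into\<close> enumerates exactly \<open>\<U>\<close> only if
    \<open>\<U>\<close> is non-empty; the added empty set is itself compact and clopen.\<close>
  define \<U> where "\<U> = insert {} (\<Union>K\<in>\<K>. \<Union>n. \<F> K n)"
  have "countable \<U>"
    unfolding \<U>_def using \<K>(1) \<F>
    by (intro countable_insert countable_UN) (auto intro: countable_finite)
  then have ran: "range (from_nat_into \<U>) = \<U>"
    by (simp add: \<U>_def range_from_nat_into)
  have pick: "\<exists>V\<in>\<U>. x \<in> V \<and> V \<in> \<B> n" if x: "x \<in> M" for x n
  proof -
    obtain K where K: "K \<in> \<K>" "x \<in> K"
      using x \<K>(3) M by (metis UnionE)
    then obtain V where "V \<in> \<F> K n" "x \<in> V"
      using \<F>[OF K(1), of n] by blast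
    then show ?thesis
      using \<F>[OF K(1), of n] K(1) unfolding \<U>_def by blast
  qed
  have clopen: "openin X V" "closedin X V" "compactin X V" if "V \<in> \<U>" for V
  proof -
    have "V = {} \<or> (\<exists>n. V \<in> \<B> n)"
      using that \<F> unfolding \<U>_def by blast
    then show "openin X V" "closedin X V" "compactin X V"
      by (auto simp: \<B>_def)
  qed
  show thesis
  proof
    fix n
    have "from_nat_into \<U> n \<in> \<U>"
      using ran by blast
    then show "openin X (from_nat_into \<U> n)" "closedin X (from_nat_into \<U> n)"
      "compactin X (from_nat_into \<U> n)"
      using clopen by auto
  next
    show "topspace X = (\<Union>n. from_nat_into \<U> n)"
      unfolding ran using pick clopen(1) openin_subset M by fastforce
  next
    fix x y assume xy: "x \<in> topspace X" "y \<in> topspace X" "x \<noteq> y"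
    then have "0 < m x y"
      by (simp add: M)
    \<comment> \<open>Half the distance, because two points of one ball may be almost twice the
      radius apart.\<close>
    then obtain n where n: "inverse (real (Suc n)) < m x y / 2"
      using reals_Archimedean half_gt_zero by metis
    obtain V where V: "V \<in> \<U>" "x \<in> V" "V \<in> \<B> n"
      using pick xy M by blast
    then obtain c where c: "V \<subseteq> mball c (inverse (Suc n))"
      by (auto simp: \<B>_def)
    have "y \<notin> V"
    proof
      assume "y \<in> V"
      with V c have "c \<in> M" "m c x < inverse (Suc n)" "m c y < inverse (Suc n)"
        by (auto simp: subset_iff)
      moreover have "m x y \<le> m c x + m c y"
        using triangle''[of x c y] xy M \<open>c \<in> M\<close> by simp
      ultimately show False
        using n by linarith
    qed
    with V ran show "\<exists>n. x \<in> from_nat_into \<U> n \<and> y \<notin> from_nat_into \<U> n"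
      by (metis rangeE)
  qed
qed

section \<open>A proper ultrametric with values in \<open>S\<close>\<close>

lemma characteristic_decseq:
  assumes "characteristic S"
  obtains s :: "nat \<Rightarrow> real"
  where "\<And>n. s n \<in> S" "\<And>n. s n > 0" "decseq s" "\<And>\<epsilon>. \<epsilon> > 0 \<Longrightarrow> \<exists>n. s n < \<epsilon>"
proof -
  have small: "\<exists>s. s \<in> S \<and> s > 0 \<and> s \<le> r" if "r > 0" for r
  proof -
    have "S \<subseteq> {0..}" and "\<exists>s\<in>S - {0}. s \<le> r"
      using assms that by (simp_all add: characteristic_def)
    then obtain s where "s \<in> S" "s \<noteq> 0" "s \<le> r" "0 \<le> s"
      by auto
    then show ?thesis
      by (intro exI[of _ s]) simp
  qed
  have "\<exists>s. \<forall>n. (s n \<in> S \<and> s n > 0 \<and> s n \<le> inverse (Suc n)) \<and> s (Suc n) \<le> s n"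
  proof (rule dependent_nat_choice)
    show "\<exists>x. x \<in> S \<and> x > 0 \<and> x \<le> inverse (Suc 0)"
      using small[of 1] by simp
  next
    fix x n assume "x \<in> S \<and> x > 0 \<and> x \<le> inverse (Suc n)"
    then show "\<exists>y. (y \<in> S \<and> y > 0 \<and> y \<le> inverse (Suc (Suc n))) \<and> y \<le> x"
      using small[of "min x (inverse (Suc (Suc n)))"] by auto
  qed
  then obtain s where s: "\<And>n. s n \<in> S" "\<And>n. s n > 0" "\<And>n. s n \<le> inverse (Suc n)"
    "\<And>n. s (Suc n) \<le> s n"
    by blast
  show thesis
  proof (rule that[OF s(1,2)])
    show "decseq s"
      using s(4) by (rule decseq_SucI)
    show "\<exists>n. s n < \<epsilon>" if "\<epsilon> > 0" for \<epsilon>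
      using reals_Archimedean[OF that] s(3) by (meson le_less_trans)
  qed
qed

lemma exists_proper_UMet:
  assumes "characteristic S" "\<not> bounded S"
    and "metrizable_space X" "ultranormal_space X" "sigma_compact_space X"
    and "locally_compact_space X" "Hausdorff_space X"
  obtains u where "u \<in> UMet X S" "proper_metric_on (topspace X) u"
proof -
  obtain U :: "nat \<Rightarrow> 'a set" where U: "\<And>n. openin X (U n)" "\<And>n. closedin X (U n)"
      "\<And>n. compactin X (U n)" "topspace X = (\<Union>n. U n)"
    and sep: "\<And>x y. x \<in> topspace X \<Longrightarrow> y \<in> topspace X \<Longrightarrow> x \<noteq> y \<Longrightarrow> \<exists>n. x \<in> U n \<and> y \<notin> U n"
    using countable_compact_clopen_cover[OF assms(3-7)] by blast
  obtain s :: "nat \<Rightarrow> real" where s: "\<And>n. s n \<in> S" "\<And>n. s n > 0" "decseq s"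
    "\<And>\<epsilon>. \<epsilon> > 0 \<Longrightarrow> \<exists>n. s n < \<epsilon>"
    using characteristic_decseq[OF assms(1)] by blast
  have S0: "0 \<in> S" "\<And>t. t \<in> S \<Longrightarrow> 0 \<le> t"
    using assms(1) by (auto simp: characteristic_def)
  \<comment> \<open>Unboundedness of \<open>S\<close> supplies the large values that will make balls
    relatively compact.\<close>
  have "\<exists>t\<in>S. real n \<le> t" for n
    using assms(2) S0(2) unfolding bounded_iff
    by (metis abs_of_nonneg linear real_norm_def)
  then obtain t where t: "\<And>n. t n \<in> S" "\<And>n. real n \<le> t n"
    by metis
  \<comment> \<open>\<open>e\<close> compares membership sequences by their first difference; the
    case distinction is there because \<open>LEAST\<close> is unspecified when the sequences agree.
    \<open>k\<close> is zero between points of equal height \<open>h\<close> and otherwise the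
    larger height, so it obeys the strong triangle inequality without separating points.\<close>
  define N where "N x y = (LEAST n. x \<in> U n \<longleftrightarrow> y \<notin> U n)" for x y
  define e where "e x y = (if \<forall>n. x \<in> U n \<longleftrightarrow> y \<in> U n then 0 else s (N x y))" for x y
  define h where "h x = t (LEAST n. x \<in> U n)" for x
  define k where "k x y = (if h x = h y then 0 else max (h x) (h y))" for x y
  define u where "u x y = max (e x y) (k x y)" for x y
  have h0: "0 \<le> h x" "h x \<in> S" for x
    using t S0 by (auto simp: h_def)
  have e0: "0 \<le> e x y" "e x y \<in> S" for x y
    using s S0 by (auto simp: e_def less_imp_le)
  have k0: "0 \<le> k x y" "k x y \<in> S" for x y
    using h0 S0 by (auto simp: k_def max_def)
  have e_sym: "e x y = e y x" for x y
  proof -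
    have "N x y = N y x"
      unfolding N_def by (rule arg_cong[where f=Least]) auto
    then show ?thesis
      by (auto simp: e_def)
  qed
  \<comment> \<open>Any separating index is at least \<open>N x y\<close>, and \<open>s\<close>
    decreases.\<close>
  have e_le: "s n \<le> e x y" if "x \<in> U n \<longleftrightarrow> y \<notin> U n" for x y n
    using that Least_le[of "\<lambda>n. x \<in> U n \<longleftrightarrow> y \<notin> U n" n] decseqD[OF s(3)]
    by (auto simp: e_def N_def)
  have N_diff: "x \<in> U (N x y) \<longleftrightarrow> y \<notin> U (N x y)" if "\<not> (\<forall>n. x \<in> U n \<longleftrightarrow> y \<in> U n)" for x y
    unfolding N_def using that by (intro LeastI_ex[of "\<lambda>n. x \<in> U n \<longleftrightarrow> y \<notin> U n"]) blast
  have e_less: "e x y < \<epsilon>" if "\<And>i. i \<le> n \<Longrightarrow> x \<in> U i \<longleftrightarrow> y \<in> U i" "s n < \<epsilon>" for x y n \<epsilon>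
  proof (cases "\<forall>i. x \<in> U i \<longleftrightarrow> y \<in> U i")
    case True
    then have "e x y = 0"
      by (simp add: e_def)
    then show ?thesis
      using s(2)[of n] that(2) by simp
  next
    case False
    then have "x \<in> U (N x y) \<longleftrightarrow> y \<notin> U (N x y)"
      using N_diff by blast
    then have "n \<le> N x y"
      using that(1)[of "N x y"] by linarith
    then have "s (N x y) \<le> s n"
      using s(3) by (rule decseqD[rotated])
    moreover have "e x y = s (N x y)"
      using False by (simp only: e_def if_False)
    ultimately show ?thesis
      using that(2) by simp
  qed
  \<comment> \<open>At the first index separating \<open>x\<close> from \<open>y\<close>, the point
    \<open>z\<close> disagrees with one of them.\<close>
  have e_tri: "e x y \<le> max (e x z) (e z y)" for x y z
  proof (cases "\<forall>i. x \<in> U i \<longleftrightarrow> y \<in> U i")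
    case True
    then have "e x y = 0"
      by (simp add: e_def)
    then show ?thesis
      using e0(1)[of x z] by simp
  next
    case False
    then have "x \<in> U (N x y) \<longleftrightarrow> y \<notin> U (N x y)"
      using N_diff by blast
    then have "s (N x y) \<le> max (e x z) (e z y)"
      using e_le[of x "N x y" z] e_le[of z "N x y" y] by fastforce
    moreover have "e x y = s (N x y)"
      using False by (simp only: e_def if_False)
    ultimately show ?thesis
      by simp
  qed
  have "ultrametric_on (topspace X) u"
  proof (rule ultrametric_onI)
    fix x y z
    show "0 \<le> u x y" "u x y = u y x"
      using e0(1)[of x y] e_sym[of x y] by (auto simp: u_def k_def max.commute)
    have "k x y \<le> max (k x z) (k z y)"
      using h0(1)[of x] h0(1)[of y] h0(1)[of z] by (auto simp: k_def)
    then show "u x y \<le> max (u x z) (u z y)"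
      using e_tri[of x y z] by (auto simp: u_def)
  next
    fix x y assume xy: "x \<in> topspace X" "y \<in> topspace X"
    have "x = y" if "u x y = 0"
    proof (rule ccontr)
      assume "x \<noteq> y"
      then obtain n where "x \<in> U n" "y \<notin> U n"
        using sep xy by blast
      then have "0 < e x y"
        using e_le[of x n y] s(2)[of n] by fastforce
      with that show False
        by (simp add: u_def)
    qed
    then show "u x y = 0 \<longleftrightarrow> x = y"
      by (auto simp: u_def e_def[of y y] k_def[of y y])
  qed
  moreover have "u x y \<in> S" for x y
    using e0 k0 by (simp add: u_def max_def)
  moreover have "\<exists>V. openin X V \<and> x \<in> V \<and> (\<forall>y\<in>V. u x y < \<epsilon>)"
    if x: "x \<in> topspace X" and \<epsilon>: "\<epsilon> > 0" for x \<epsilon>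
  proof -
    obtain n where n: "s n < \<epsilon>"
      using s(4)[OF \<epsilon>] by blast
    obtain l where l: "x \<in> U l" "l = (LEAST n. x \<in> U n)"
      using x U(4) by (metis (mono_tags, lifting) LeastI UN_E)
    \<comment> \<open>Agreement with \<open>x\<close> up to \<open>n\<close> makes \<open>e\<close>
      small; agreement up to \<open>l\<close> fixes the first index, hence \<open>h\<close>, so
      \<open>k\<close> vanishes. Complements are allowed since the \<open>U i\<close> are
      clopen.\<close>
    define V where "V = (\<Inter>i\<in>{..max n l}. if x \<in> U i then U i else topspace X - U i)"
    have "openin X V"
      unfolding V_def using U(1,2) by (intro openin_Inter) auto
    moreover have "x \<in> V"
      using x by (auto simp: V_def)
    moreover have "u x y < \<epsilon>" if y: "y \<in> V" for y
    proof -
      have same: "x \<in> U i \<longleftrightarrow> y \<in> U i" if "i \<le> max n l" for i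
        using y that unfolding V_def by (auto split: if_splits dest!: INT_D[of _ _ _ i])
      have "(LEAST n. y \<in> U n) = l"
      proof (rule Least_equality)
        show "y \<in> U l"
          using same[of l] l(1) by simp
        show "l \<le> i" if "y \<in> U i" for i
          using same[of i] that Least_le[of "\<lambda>n. x \<in> U n" i] l(2) by linarith
      qed
      then have "k x y = 0"
        using l(2) by (simp add: k_def h_def)
      moreover have "e x y < \<epsilon>"
        using same n by (intro e_less[of n]) auto
      ultimately show ?thesis
        using \<epsilon> by (simp add: u_def)
    qed
    ultimately show ?thesis
      by blast
  qed
  moreover have "\<exists>K. compactin X K \<and> {y \<in> topspace X. u x y \<le> R} \<subseteq> K"
    if x: "x \<in> topspace X" for x R
  proof -
    \<comment> \<open>If \<open>u x y \<le> R\<close>, then either \<open>h y = h x\<close> or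
      \<open>h y \<le> R\<close>. As \<open>t n \<ge> n\<close>, the first index of \<open>y\<close>
      is then at most \<open>r\<close>.\<close>
    define r where "r = max R (h x)"
    have "y \<in> (\<Union>n\<in>{..nat \<lfloor>r\<rfloor>}. U n)" if y: "y \<in> topspace X" "u x y \<le> R" for y
    proof -
      have "h y \<le> r"
        using y(2) by (auto simp: u_def k_def r_def split: if_splits)
      then have "(LEAST n. y \<in> U n) \<le> nat \<lfloor>r\<rfloor>"
        using t(2)[of "LEAST n. y \<in> U n"] by (simp add: h_def le_nat_floor)
      moreover have "y \<in> U (LEAST n. y \<in> U n)"
        using y(1) U(4) by (metis (mono_tags, lifting) LeastI UN_E)
      ultimately show ?thesis
        by blast
    qed
    moreover have "compactin X (\<Union>n\<in>{..nat \<lfloor>r\<rfloor>}. U n)"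
      using U(3) by (intro compactin_Union) auto
    ultimately show ?thesis
      by (intro exI[of _ "\<Union>n\<in>{..nat \<lfloor>r\<rfloor>}. U n"]) blast
  qed
  ultimately show thesis
    using UMet_properI[of X u S] that by blast
qed

section \<open>Nearest points and the quotient by \<open>A\<close>\<close>

text \<open>With any \<open>c\<close> in \<open>A\<close>, properness makes the part of
  \<open>A\<close> within \<open>u x c\<close> of \<open>x\<close> compact, so the distance attains
  its minimum there; the rest of \<open>A\<close> is farther away than \<open>c\<close>.\<close>

lemma proper_metric_nearest_point:
  assumes "Metric_space M u" "proper_metric_on M u"
    and A: "closedin (Metric_space.mtopology M u) A" "A \<noteq> {}" and x: "x \<in> M"
  shows "\<exists>a\<in>A. \<forall>b\<in>A. u x a \<le> u x b"
proof -
  interpret Metric_space M u by fact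
  obtain c where c: "c \<in> A"
    using A(2) by blast
  have "A \<subseteq> M"
    using A(1) closedin_subset by fastforce
  define C where "C = A \<inter> mcball x (u x c)"
  have "compactin mtopology C"
    using assms(2) A(1) mbounded_subset[OF mbounded_mcball, of C]
    unfolding proper_metric_on_def C_def by blast
  moreover have "continuous_map mtopology euclideanreal (u x)"
    using continuous_on_mdist[of x "metric (M, u)"] x
    by (simp add: mtopology_of_def mspace_metric mdist_metric)
  ultimately have "compact (u x ` C)"
    using image_compactin by fastforce
  moreover have "c \<in> C"
    using c x \<open>A \<subseteq> M\<close> by (auto simp: C_def)
  ultimately obtain a where a: "a \<in> C" "\<forall>b\<in>C. u x a \<le> u x b"
    using compact_attains_inf[of "u x ` C"] by blast
  have "u x a \<le> u x b" if "b \<in> A" for b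
  proof (cases "b \<in> C")
    case False
    then have "u x c < u x b"
      using that x \<open>A \<subseteq> M\<close> by (auto simp: C_def)
    then show ?thesis
      using a(2) \<open>c \<in> C\<close> by fastforce
  qed (use a(2) in blast)
  with a(1) show ?thesis
    by (auto simp: C_def)
qed

text \<open>
  If \<open>r\<close> is a nearest-point map onto \<open>A\<close>, the following function is the quotient ultrametric
  obtained from \<open>u\<close> by collapsing \<open>A\<close> to a point.
\<close>

definition collapse :: "('a \<Rightarrow> 'a \<Rightarrow> real) \<Rightarrow> ('a \<Rightarrow> 'a) \<Rightarrow> 'a \<Rightarrow> 'a \<Rightarrow> real" where
  "collapse u r x y = min (u x y) (max (u x (r x)) (u y (r y)))"

text \<open>The distance to \<open>A\<close>, which is \<open>u p (r p)\<close>, grows from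
  \<open>q\<close> to \<open>p\<close> at most to its maximum with \<open>u p q\<close>. This
  settles the cases in which a path through \<open>z\<close> uses the collapsed set.\<close>

lemma collapse_ultra:
  assumes u: "ultrametric_on M u" and A: "A \<subseteq> M"
    and r: "\<And>x. x \<in> M \<Longrightarrow> r x \<in> A" "\<And>x b. x \<in> M \<Longrightarrow> b \<in> A \<Longrightarrow> u x (r x) \<le> u x b"
    and xyz: "x \<in> M" "y \<in> M" "z \<in> M"
  shows "collapse u r x y \<le> max (collapse u r x z) (collapse u r z y)"
proof -
  have sym: "u p q = u q p" for p q
    using u unfolding ultrametric_on_def by (metis Metric_space.commute)
  have step: "u p (r p) \<le> max (u p q) (u q (r q))" if "p \<in> M" "q \<in> M" for p q
  proof -
    have "u p (r p) \<le> u p (r q)"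
      using r that by blast
    also have "\<dots> \<le> max (u p q) (u q (r q))"
      using u A r(1) that unfolding ultrametric_on_def by blast
    finally show ?thesis .
  qed
  have "u x y \<le> max (u x z) (u z y)"
    using u xyz unfolding ultrametric_on_def by blast
  then show ?thesis
    using step[OF xyz(1,3)] step[OF xyz(2,3)] sym[of y z]
    unfolding collapse_def by linarith
qed

section \<open>Extension from \<open>A\<close> to \<open>X\<close>\<close>

theorem theorem3p15:
  fixes X :: "'a topology" and A :: "'a set" and S :: "real set" and d :: "'a \<Rightarrow> 'a \<Rightarrow> real"
  assumes "characteristic S" and "\<not> bounded S"
    and "metrizable_space X"
    and "ultranormal_space X" and "sigma_compact_space X"
    and "locally_compact_space X" and "Hausdorff_space X"
    and "closedin X A" and "A \<noteq> {}"
    and "d \<in> UMet (subtopology X A) S" and "proper_metric_on A d"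
  shows "\<exists>D. D \<in> UMet X S \<and> proper_metric_on (topspace X) D \<and>
             (\<forall>x\<in>A. \<forall>y\<in>A. D x y = d x y)"
proof -
  obtain u where u: "u \<in> UMet X S" "proper_metric_on (topspace X) u"
    using exists_proper_UMet assms(1-7) by blast
  have sub: "A \<subseteq> topspace X"
    using assms(8) by (rule closedin_subset)
  then have topA: "topspace (subtopology X A) = A"
    by auto
  have ultra: "ultrametric_on (topspace X) u"
    and uS: "\<And>x y. x \<in> topspace X \<Longrightarrow> y \<in> topspace X \<Longrightarrow> u x y \<in> S"
    and ultra_d: "ultrametric_on A d" and dS: "\<And>x y. x \<in> A \<Longrightarrow> y \<in> A \<Longrightarrow> d x y \<in> S"
    using u(1) assms(10) unfolding UMet_def topA by blast+
  interpret u: Metric_space "topspace X" u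
    using ultra by (simp add: ultrametric_on_def)
  interpret d: Metric_space A d
    using ultra_d by (simp add: ultrametric_on_def)
  have utop: "u.mtopology = X" and dtop: "d.mtopology = subtopology X A"
    using u(1) assms(10) unfolding UMet_def topA by blast+
  have u3: "u x y \<le> max (u x z) (u z y)"
    if "x \<in> topspace X" "y \<in> topspace X" "z \<in> topspace X" for x y z
    using ultra that by (simp add: ultrametric_on_def)
  have d3: "d x y \<le> max (d x z) (d z y)" if "x \<in> A" "y \<in> A" "z \<in> A" for x y z
    using ultra_d that by (simp add: ultrametric_on_def)
  define P where "P x = {a \<in> A. \<forall>b\<in>A. u x a \<le> u x b}" for x
  \<comment> \<open>The choice depends only on the set \<open>P x\<close>, so equal sets of nearest
    points yield the same value of \<open>r\<close>.\<close>
  define r where "r x = (SOME a. a \<in> P x)" for x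
  have rP: "r x \<in> P x" if "x \<in> topspace X" for x
  proof -
    have "\<exists>a\<in>A. \<forall>b\<in>A. u x a \<le> u x b"
      using proper_metric_nearest_point[OF u.Metric_space_axioms u(2)] utop assms(8,9) that
      by simp
    then have "\<exists>a. a \<in> P x"
      by (auto simp: P_def)
    then show ?thesis
      unfolding r_def by (rule someI_ex)
  qed
  have rA: "r x \<in> A" and r_le: "\<And>b. b \<in> A \<Longrightarrow> u x (r x) \<le> u x b" if "x \<in> topspace X" for x
    using rP[OF that] by (auto simp: P_def)
  then have rX: "r x \<in> topspace X" if "x \<in> topspace X" for x
    using sub that by blast
  have r_id: "r x = x" if "x \<in> A" for x
    using r_le[of x x] that sub u.nonneg[of x "r x"] rX[of x] by (auto simp: subset_iff)
  \<comment> \<open>Every \<open>b\<close> in \<open>A\<close> is farther from \<open>x\<close> than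
    \<open>y\<close> is, so the isosceles property of ultrametrics gives
    \<open>u y b = u x b\<close>.\<close>
  have r_const: "r y = r x"
    if xy: "x \<in> topspace X" "y \<in> topspace X" "u x y < u x (r x)" for x y
  proof -
    have "u y b = u x b" if "b \<in> A" for b
    proof -
      have "u x y < u x b" "b \<in> topspace X"
        using r_le[OF xy(1) that] xy(3) sub that by auto
      then show ?thesis
        using u3[of x b y] u3[of y b x] u.commute[of x y] xy(1,2) by auto
    qed
    then have "P y = P x"
      by (auto simp: P_def)
    then show ?thesis
      by (simp add: r_def)
  qed
  \<comment> \<open>Off \<open>A\<close> the map \<open>r\<close> is locally constant by
    \<open>r_const\<close>. At \<open>x\<close> in \<open>A\<close>, the nearest point
    \<open>r y\<close> is no farther from \<open>y\<close> than \<open>x\<close> is, so it stays in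
    the same \<open>u\<close>-ball around \<open>x\<close>.\<close>
  have r_cont: "\<exists>\<delta>>0. \<forall>y\<in>topspace X. u x y < \<delta> \<longrightarrow> d (r x) (r y) < \<epsilon>"
    if x: "x \<in> topspace X" and \<epsilon>: "\<epsilon> > 0" for x \<epsilon>
  proof (cases "x \<in> A")
    case False
    then have "x \<noteq> r x"
      using rA[OF x] by auto
    then have "u x (r x) > 0"
      using x rX[OF x] by simp
    moreover have "d (r x) (r y) < \<epsilon>" if "y \<in> topspace X" "u x y < u x (r x)" for y
      using r_const[OF x that] \<epsilon> rA[OF x] by simp
    ultimately show ?thesis
      by blast
  next
    case True
    have "openin (subtopology X A) (d.mball x \<epsilon>)"
      unfolding dtop[symmetric] by simp
    then obtain W where W: "openin X W" "d.mball x \<epsilon> = W \<inter> A"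
      by (auto simp: openin_subtopology)
    then have "x \<in> W"
      using True \<epsilon> d.centre_in_mball_iff by blast
    then obtain \<delta> where \<delta>: "\<delta> > 0" "u.mball x \<delta> \<subseteq> W"
      using W(1) u.openin_mtopology utop by metis
    have "d (r x) (r y) < \<epsilon>" if y: "y \<in> topspace X" "u x y < \<delta>" for y
    proof -
      have "u y (r y) \<le> u y x"
        using r_le y(1) True by blast
      then have "u x (r y) < \<delta>"
        using u3[OF x rX[OF y(1)] y(1)] y(2) u.commute[of x y] by auto
      then have "r y \<in> W \<inter> A"
        using \<delta>(2) x rX[OF y(1)] rA[OF y(1)] by (auto simp: subset_iff)
      then show ?thesis
        using W(2) r_id[OF True] d.in_mball by metis
    qed
    with \<delta>(1) show ?thesis
      by blast
  qed
  define v where "v = collapse u r"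
  have v_nonneg: "0 \<le> v x y" and v_sym: "v x y = v y x" and v_le: "v x y \<le> u x y" for x y
    by (auto simp: v_def collapse_def u.commute max.commute le_max_iff_disj)
  have vS: "v x y \<in> S" if "x \<in> topspace X" "y \<in> topspace X" for x y
    using uS that rX by (auto simp: v_def collapse_def min_def max_def)
  define D where "D x y = max (d (r x) (r y)) (v x y)" for x y
  have ext: "\<forall>x\<in>A. \<forall>y\<in>A. D x y = d x y"
  proof (intro ballI)
    fix x y assume xy: "x \<in> A" "y \<in> A"
    then have "u x x = 0" "u y y = 0"
      using sub by auto
    then have "v x y = 0"
      using r_id xy by (simp add: v_def collapse_def)
    then show "D x y = d x y"
      using r_id xy by (simp add: D_def)
  qed
  have ultra_D: "ultrametric_on (topspace X) D"
  proof (rule ultrametric_onI)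
    fix x y z
    show "0 \<le> D x y" "D x y = D y x"
      using v_nonneg v_sym by (auto simp: D_def d.commute le_max_iff_disj)
    assume xyz: "x \<in> topspace X" "y \<in> topspace X" "z \<in> topspace X"
    have "v x y \<le> max (v x z) (v z y)"
      unfolding v_def using collapse_ultra[OF ultra sub _ _ xyz] rA r_le by blast
    then show "D x y \<le> max (D x z) (D z y)"
      using d3[of "r x" "r y" "r z"] rA xyz by (auto simp: D_def)
  next
    fix x y assume xy: "x \<in> topspace X" "y \<in> topspace X"
    have "x = y" if "D x y = 0"
    proof -
      have "d (r x) (r y) = 0" "v x y = 0"
        using that v_nonneg[of x y] d.nonneg[of "r x" "r y"] unfolding D_def by linarith+
      then have "r x = r y"
        using xy rA by simp
      \<comment> \<open>\<open>v\<close> vanishes only if \<open>x = y\<close> or both points lie in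
        \<open>A\<close>, where they equal their retractions.\<close>
      moreover have "u x y = 0 \<or> u x (r x) = 0 \<and> u y (r y) = 0"
        using \<open>v x y = 0\<close> u.nonneg[of x "r x"] u.nonneg[of y "r y"]
        unfolding v_def collapse_def by linarith
      ultimately show ?thesis
        using xy rX by (metis u.zero)
    qed
    then show "D x y = 0 \<longleftrightarrow> x = y"
      using xy rA rX v_nonneg[of x x] v_le[of x x] by (auto simp: D_def)
  qed
  have nbhd: "\<exists>U. openin X U \<and> x \<in> U \<and> (\<forall>y\<in>U. D x y < \<epsilon>)"
    if x: "x \<in> topspace X" and \<epsilon>: "\<epsilon> > 0" for x \<epsilon>
  proof -
    obtain \<delta> where \<delta>: "\<delta> > 0" "\<And>y. y \<in> topspace X \<Longrightarrow> u x y < \<delta> \<Longrightarrow> d (r x) (r y) < \<epsilon>"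
      using r_cont[OF x \<epsilon>] by blast
    show ?thesis
    proof (intro exI conjI ballI)
      show "openin X (u.mball x (min \<delta> \<epsilon>))"
        using u.openin_mball utop by metis
      show "x \<in> u.mball x (min \<delta> \<epsilon>)"
        using x \<delta>(1) \<epsilon> by simp
      show "D x y < \<epsilon>" if "y \<in> u.mball x (min \<delta> \<epsilon>)" for y
        using that \<delta>(2)[of y] v_le[of x y] by (auto simp: D_def)
    qed
  qed
  have bdd: "\<exists>K. compactin X K \<and> {y \<in> topspace X. D x y \<le> R} \<subseteq> K"
    if x: "x \<in> topspace X" for x R
  proof -
    have "closedin d.mtopology (d.mcball (r x) R)" "d.mbounded (d.mcball (r x) R)"
      by (auto simp: d.mbounded_mcball)
    then have "compactin d.mtopology (d.mcball (r x) R)"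
      using assms(11) unfolding proper_metric_on_def by blast
    \<comment> \<open>Properness of \<open>d\<close> turns its ball into a compact subset of
      \<open>X\<close>, on which \<open>u\<close> is bounded although \<open>u\<close> and
      \<open>d\<close> are not otherwise comparable.\<close>
    then have "compactin u.mtopology (d.mcball (r x) R)"
      by (simp add: dtop utop compactin_subtopology)
    then have "u.mbounded (d.mcball (r x) R)"
      by (rule u.compactin_imp_mbounded)
    then obtain B where B: "\<And>p q. p \<in> d.mcball (r x) R \<Longrightarrow> q \<in> d.mcball (r x) R \<Longrightarrow> u p q \<le> B"
      unfolding u.mbounded_alt by blast
    \<comment> \<open>\<open>D x y \<le> R\<close> leaves two cases: \<open>u x y \<le> R\<close>,
      or \<open>u y (r y) \<le> R\<close>. In the second, the chain \<open>x\<close>,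
      \<open>r x\<close>, \<open>r y\<close>, \<open>y\<close> has steps bounded by
      \<open>u x (r x)\<close>, \<open>B\<close> and \<open>R\<close>.\<close>
    define R' where "R' = Max {R, u x (r x), B}"
    have R': "R \<le> R'" "u x (r x) \<le> R'" "B \<le> R'"
      by (auto simp: R'_def)
    have "u x y \<le> R'" if y: "y \<in> topspace X" "D x y \<le> R" for y
    proof -
      have dy: "d (r x) (r y) \<le> R" and vy: "v x y \<le> R"
        using y(2) by (auto simp: D_def)
      have "0 \<le> R"
        using dy d.nonneg order_trans by blast
      then have "u (r x) (r y) \<le> B"
        using dy rA x y(1) by (intro B) auto
      moreover have "u x y \<le> R \<or> u y (r y) \<le> R"
        using vy by (auto simp: v_def collapse_def min_le_iff_disj)
      ultimately show ?thesis
        using R' u3[OF x y(1) rX[OF x]] u3[OF rX[OF x] y(1) rX[OF y(1)]] u.commute[of y "r y"]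
        by linarith
    qed
    then have "{y \<in> topspace X. D x y \<le> R} \<subseteq> u.mcball x R'"
      using x by auto
    moreover have "compactin X (u.mcball x R')"
      using u(2) u.closedin_mcball u.mbounded_mcball utop unfolding proper_metric_on_def
      by metis
    ultimately show ?thesis
      by blast
  qed
  have "D x y \<in> S" if "x \<in> topspace X" "y \<in> topspace X" for x y
    using that vS dS rA by (simp add: D_def max_def)
  then have "D \<in> UMet X S" "proper_metric_on (topspace X) D"
    using UMet_properI[OF ultra_D _ nbhd bdd] by blast+
  with ext show ?thesis
    by blast
qed

end
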